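(* Let the payment to supplier $i$ be $$p_i(\hat{\bm x},\hat{\bm\gamma})=\{r(\bm{x}^* ) - r(\bm{z}_{i}^* )\}-\sum_{k=1, k\ne i}^{n}\{c(x_k^*, \hat{\gamma}_k) - c(z_{ik}^*, \hat{\gamma}_k)\},$$ where $\bm x^*=\bm x^*(\hat{\bm x},\hat{\bm\gamma})$ and $\bm z_i^*=(z_{i1}^*,\dots,z_{in}^* )$ is the optimal allocation when supplier $i$'s capacity is set to $0$. If reports are truthful, $(\hat{\bm x},\hat{\bm\gamma})=(\bar{\bm x},\bm\gamma)$, then every supplier is ex-post individually rational: $$p_i(\hat{\bm{x}}, \hat{\bm{\gamma}})\ \ge\ c(x_i^*(\hat{\bm{x}}, \hat{\bm{\gamma}}), \gamma_i),\qquad \forall i\in N.$$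
   Context: There are $n$ suppliers $N=\{1,\dots,n\}$. Supplier $i$ supplies an amount $x_i\ge0$; $\bm x\in\mathbb{R}_{\ge0}^n$ is the procurement level. Supplier $i$ has a true capacity limit $\bar x_i\ge0$ and a true cost type $\gamma_i$ in a set $\Gamma$; its cost of supplying $x_i$ is $c(x_i,\gamma_i)$. The coordinator's revenue is $r(\bm x)$. Inequalities between vectors are componentwise; $(0,\hat{\bm x}_{-i})$ denotes $\hat{\bm x}$ with its $i$th entry replaced by $0$. Standing assumptions: $r$ is smooth and monotonically increasing (in each coordinate) on $\mathbb{R}_{\ge0}^n$; for each $\gamma\in\Gamma$, $c(\cdot,\gamma)$ is smooth and monotonically increasing on $\mathbb{R}_{\ge0}$; $r(\bm 0)=0$ and $c(0,\gamma)=0$ for all $\gamma\in\Gamma$. Suppliers report capacity limits $\hat{\bm x}\ge\bm0$ and cost types $\hat{\bm\gamma}\in\Gamma^n$. The social surplus is $S(\bm x,\bm\gamma)=r(\bm x)-\sum_{i=1}^n c(x_i,\gamma_i)$. The allocation $\bm x^*(\hat{\bm x},\hat{\bm\gamma})$ is a (fixed choice of) maximizer of $S(\bm x,\hat{\bm\gamma})$ over $\bm0\le\bm x\le\hat{\bm x}$, and $\bm z_i^*$ is a (fixed choice of) maximizer of $S(\bm z,\hat{\bm\gamma})$ over $\bm0\le\bm z\le(0,\hat{\bm x}_{-i})$ (so $z_{ii}^*=0$). *)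

theory Defs
  imports "HOL-Analysis.Analysis"
begin

text \<open>Continuous differentiability of order \<open>k\<close> on an open set, via iterated directional derivatives.\<close>

primrec Ck_on_open ::
  "nat \<Rightarrow> ('a::euclidean_space \<Rightarrow> 'b::real_normed_vector) \<Rightarrow> 'a set \<Rightarrow> bool" where
  "Ck_on_open 0 f U \<longleftrightarrow> continuous_on U f"
| "Ck_on_open (Suc k) f U \<longleftrightarrow>
     (\<forall>x\<in>U. f differentiable (at x)) \<and>
     (\<forall>v. Ck_on_open k (\<lambda>x. frechet_derivative f (at x) v) U)"

text \<open>The domains of interest, the nonnegative orthant and half-line, are not open. Smoothness
  there means, as usual, having a \<open>C\<^sup>\<infinity>\<close> extension to an open neighbourhood.\<close>

definition smooth_on ::
  "('a::euclidean_space \<Rightarrow> 'b::real_normed_vector) \<Rightarrow> 'a set \<Rightarrow> bool" where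
  "smooth_on f S \<longleftrightarrow>
     (\<exists>U g. open U \<and> S \<subseteq> U \<and> (\<forall>x\<in>S. g x = f x) \<and> (\<forall>k. Ck_on_open k g U))"

text \<open>The order on \<^typ>\<open>real ^ 'n\<close> is the componentwise one.\<close>

abbreviation orthant :: "(real ^ 'n) set" where
  "orthant \<equiv> {x. 0 \<le> x}"

definition replace_entry :: "'n \<Rightarrow> 'a \<Rightarrow> 'a ^ 'n \<Rightarrow> 'a ^ 'n" where
  "replace_entry i t x = (\<chi> j. if j = i then t else x $ j)"

definition increasing_in_each_coordinate :: "(real ^ 'n \<Rightarrow> real) \<Rightarrow> bool" where
  "increasing_in_each_coordinate r \<longleftrightarrow>
     (\<forall>x\<in>orthant. \<forall>i. mono_on {0..} (\<lambda>t. r (replace_entry i t x)))"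

definition social_surplus ::
  "(real ^ 'n::finite \<Rightarrow> real) \<Rightarrow> (real \<Rightarrow> 'g \<Rightarrow> real) \<Rightarrow> real ^ 'n \<Rightarrow> 'g ^ 'n \<Rightarrow> real" where
  "social_surplus r c x \<gamma> = r x - (\<Sum>i\<in>UNIV. c (x $ i) (\<gamma> $ i))"

definition optimal_procurement ::
  "(real ^ 'n::finite \<Rightarrow> real) \<Rightarrow> (real \<Rightarrow> 'g \<Rightarrow> real) \<Rightarrow> real ^ 'n \<Rightarrow> 'g ^ 'n \<Rightarrow> real ^ 'n \<Rightarrow> bool" where
  "optimal_procurement r c b \<gamma> x \<longleftrightarrow>
     is_arg_max (\<lambda>y. social_surplus r c y \<gamma>) (\<lambda>y. 0 \<le> y \<and> y \<le> b) x"

text \<open>In \<open>payment\<close>, \<open>xs\<close> and \<open>zs\<close> are choice functions taking reports to the selected maximizers: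
  \<open>xs x\<^sub>r \<gamma>\<^sub>r\<close> is the allocation and \<open>zs i x\<^sub>r \<gamma>\<^sub>r\<close> the one with the capacity of \<open>i\<close> set to \<open>0\<close>.\<close>

definition payment ::
  "(real ^ 'n::finite \<Rightarrow> real) \<Rightarrow> (real \<Rightarrow> 'g \<Rightarrow> real) \<Rightarrow>
   (real ^ 'n \<Rightarrow> 'g ^ 'n \<Rightarrow> real ^ 'n) \<Rightarrow> ('n \<Rightarrow> real ^ 'n \<Rightarrow> 'g ^ 'n \<Rightarrow> real ^ 'n) \<Rightarrow>
   'n \<Rightarrow> real ^ 'n \<Rightarrow> 'g ^ 'n \<Rightarrow> real" where
  "payment r c xs zs i x\<^sub>r \<gamma>\<^sub>r =
     (r (xs x\<^sub>r \<gamma>\<^sub>r) - r (zs i x\<^sub>r \<gamma>\<^sub>r)) -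
     (\<Sum>k\<in>UNIV - {i}. c (xs x\<^sub>r \<gamma>\<^sub>r $ k) (\<gamma>\<^sub>r $ k) - c (zs i x\<^sub>r \<gamma>\<^sub>r $ k) (\<gamma>\<^sub>r $ k))"

end

(* The payment to supplier i is the surplus it adds, S(x^* ) - S(z_i^* ), plus its own cost at x^*,
   because z_i^* procures nothing from i. Lowering the capacity of i to 0 only shrinks the feasible
   box, so the added surplus is nonnegative. *)
theory Submission
  imports Defs
begin

lemma replace_entry_zero_le:
  fixes x :: "real ^ 'n::finite"
  assumes "0 \<le> x"
  shows "replace_entry i 0 x \<le> x"
  using assms by (simp add: less_eq_vec_def replace_entry_def)

text \<open>In direction \<open>i\<close> the feasible box degenerates to the single point 0. This
  is what removes the cost of \<open>i\<close> at \<open>z\<close> from the payment.\<close>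

lemma optimal_procurement_replace_zero:
  assumes "optimal_procurement r c (replace_entry i 0 b) \<gamma> z"
  shows "z $ i = 0"
proof -
  have "0 \<le> z" "z \<le> replace_entry i 0 b"
    using assms by (auto simp: optimal_procurement_def is_arg_max_def)
  then have "0 \<le> z $ i" "z $ i \<le> replace_entry i 0 b $ i"
    by (auto simp: less_eq_vec_def)
  then show ?thesis
    by (simp add: replace_entry_def)
qed

text \<open>By transitivity \<open>z\<close> also lies in the box bounded by \<open>b'\<close>,
  where it competes with the maximizer \<open>x\<close>.\<close>

lemma optimal_surplus_mono:
  assumes "b \<le> b'" "optimal_procurement r c b \<gamma> z" "optimal_procurement r c b' \<gamma> x"
  shows "social_surplus r c z \<gamma> \<le> social_surplus r c x \<gamma>"
  using assms unfolding optimal_procurement_def is_arg_max_linorder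
  by (meson order_trans)

text \<open>Pure algebra for arbitrary \<open>xs\<close> and \<open>zs\<close>: splitting the term
  of \<open>i\<close> off each full cost sum leaves the sum over \<open>UNIV - {i}\<close>. The last
  cost term vanishes only once \<open>zs\<close> is known to be optimal.\<close>

lemma payment_eq_surplus_gain:
  "payment r c xs zs i b \<gamma> =
     social_surplus r c (xs b \<gamma>) \<gamma> - social_surplus r c (zs i b \<gamma>) \<gamma>
     + c (xs b \<gamma> $ i) (\<gamma> $ i) - c (zs i b \<gamma> $ i) (\<gamma> $ i)"
  by (simp add: payment_def social_surplus_def sum_subtractf sum.remove[of UNIV i])


theorem proposition3:
  fixes r :: "real ^ 'n::finite \<Rightarrow> real"
    and c :: "real \<Rightarrow> 'g \<Rightarrow> real"
    and \<Gamma> :: "'g set"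
    and x_opt :: "real ^ 'n \<Rightarrow> 'g ^ 'n \<Rightarrow> real ^ 'n"
    and z_opt :: "'n \<Rightarrow> real ^ 'n \<Rightarrow> 'g ^ 'n \<Rightarrow> real ^ 'n"
    and x_true x_rep :: "real ^ 'n"
    and \<gamma>_true \<gamma>_rep :: "'g ^ 'n"
  assumes r_smooth: "smooth_on r orthant"
    and r_increasing: "increasing_in_each_coordinate r"
    and r_zero: "r 0 = 0"
    and c_smooth: "\<forall>\<gamma>\<in>\<Gamma>. smooth_on (\<lambda>t. c t \<gamma>) {0..}"
    and c_increasing: "\<forall>\<gamma>\<in>\<Gamma>. mono_on {0..} (\<lambda>t. c t \<gamma>)"
    and c_zero: "\<forall>\<gamma>\<in>\<Gamma>. c 0 \<gamma> = 0"
    and x_opt: "\<forall>x \<gamma>. 0 \<le> x \<and> (\<forall>k. \<gamma> $ k \<in> \<Gamma>) \<longrightarrow>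
                  optimal_procurement r c x \<gamma> (x_opt x \<gamma>)"
    and z_opt: "\<forall>i x \<gamma>. 0 \<le> x \<and> (\<forall>k. \<gamma> $ k \<in> \<Gamma>) \<longrightarrow>
                  optimal_procurement r c (replace_entry i 0 x) \<gamma> (z_opt i x \<gamma>)"
    and true_types: "0 \<le> x_true" "\<forall>k. \<gamma>_true $ k \<in> \<Gamma>"
    and reports: "0 \<le> x_rep" "\<forall>k. \<gamma>_rep $ k \<in> \<Gamma>"
    and truthful: "x_rep = x_true" "\<gamma>_rep = \<gamma>_true"
  shows "\<forall>i. payment r c x_opt z_opt i x_rep \<gamma>_rep \<ge> c (x_opt x_rep \<gamma>_rep $ i) (\<gamma>_true $ i)"
proof
  fix i
  let ?x = "x_opt x_rep \<gamma>_rep" and ?z = "z_opt i x_rep \<gamma>_rep"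
  have opt_x: "optimal_procurement r c x_rep \<gamma>_rep ?x"
    and opt_z: "optimal_procurement r c (replace_entry i 0 x_rep) \<gamma>_rep ?z"
    using x_opt z_opt reports by blast+
  have "c (?z $ i) (\<gamma>_rep $ i) = 0"
    using optimal_procurement_replace_zero[OF opt_z] c_zero reports(2) by simp
  moreover have "social_surplus r c ?z \<gamma>_rep \<le> social_surplus r c ?x \<gamma>_rep"
    \<comment> \<open>Since capacities are nonnegative, setting entry \<open>i\<close> to 0 can only
      lower it.\<close>
    using replace_entry_zero_le[OF reports(1)] opt_z opt_x by (rule optimal_surplus_mono)
  ultimately show "payment r c x_opt z_opt i x_rep \<gamma>_rep \<ge> c (?x $ i) (\<gamma>_true $ i)"
    \<comment> \<open>The payment contains the cost of \<open>i\<close> at its reported type, the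
      claim at its true type; truthfulness identifies them, and what remains is the nonnegative
      surplus gain.\<close>
    unfolding payment_eq_surplus_gain truthful(2) by linarith
qed

end
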